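(* There is an absolute constant $C>0$ such that the following holds. Let $\epsilon\in(0,1)$ and $k\in\mathbb{N}$. Let $A,M,L,S$ be finite nonempty subsets of an abelian group $G$, suppose $|A+S|\le K|A|$ and that $\eta:=|M|/|L|\le1$. Then there is a set $T\subset S$ with \[ |T|\ge\exp\left(-Ck^2\epsilon^{-2}\log(2/\eta)\log(2K)\right)|S| \] such that \[ \|1_A*1_M*1_L(\cdot+t)-1_A*1_M*1_L\|_\infty\le\epsilon|A||M|\quad\text{for all }t\in kT-kT. \]
   Context: For finitely supported $f,g:G\to\mathbb{C}$, $f*g(x)=\sum_{y\in G}f(y)g(x-y)$ and $\|f\|_\infty=\max_x|f(x)|$; $1_X$ denotes the indicator function of $X$. $kT-kT$ is the set of all sums $t_1+\cdots+t_k-t_1'-\cdots-t_k'$ with $t_i,t_i'\in T$. $A+S=\{a+s:a\in A,s\in S\}$. *)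

theory Defs
  imports Complex_Main "HOL-Library.Indicator_Function" "HOL-Algebra.Algebra"
begin

text \<open>
  Abelian groups are \<^locale>\<open>comm_group\<close> structures and hence written multiplicatively:
  \<open>x - y\<close> is \<open>x \<otimes> inv y\<close> and \<open>A + S\<close> is \<open>A <#> S\<close>.
  Functions on a group are only ever evaluated on its carrier.
\<close>

text \<open>Summing over the support keeps the sum finite in an infinite group.\<close>

definition conv ::
  "('a, 'b) monoid_scheme \<Rightarrow> ('a \<Rightarrow> complex) \<Rightarrow> ('a \<Rightarrow> complex) \<Rightarrow> 'a \<Rightarrow> complex" where
  "conv G f g x = (\<Sum>y | y \<in> carrier G \<and> f y \<noteq> 0. f y * g (x \<otimes>\<^bsub>G\<^esub> inv\<^bsub>G\<^esub> y))"

text \<open>A finitely supported function takes finitely many values, so the maximum exists.\<close>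

definition sup_norm :: "('a, 'b) monoid_scheme \<Rightarrow> ('a \<Rightarrow> complex) \<Rightarrow> real" where
  "sup_norm G f = Max ((\<lambda>x. cmod (f x)) ` carrier G)"

text \<open>The set \<open>kT - kT\<close>; for \<open>k = 0\<close> the sums are empty and it is the trivial subgroup.\<close>

definition iterated_difference_set ::
  "('a, 'b) monoid_scheme \<Rightarrow> nat \<Rightarrow> 'a set \<Rightarrow> 'a set" where
  "iterated_difference_set G k T =
    {finprod G t {..<k} \<otimes>\<^bsub>G\<^esub> inv\<^bsub>G\<^esub> (finprod G t' {..<k}) | t t'.
       t \<in> {..<k} \<rightarrow> T \<and> t' \<in> {..<k} \<rightarrow> T}"

text \<open>
  That the constant is absolute, i.e. independent of the carrier type as well, cannot be said by
  one existential quantifier, as types are quantified outermost. It is expressed instead by: some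
  \<open>C > 0\<close> works for all abelian groups on sets of natural numbers, and for an arbitrary type,
  every such \<open>C\<close> works for all abelian groups on sets of that type.
\<close>

definition almost_periodicity_bound :: "real \<Rightarrow> ('a, 'b) monoid_scheme \<Rightarrow> bool" where
  "almost_periodicity_bound C G \<longleftrightarrow>
    (\<forall>(\<epsilon>::real) (k::nat) (K::real) (\<eta>::real) A M L S.
       0 < \<epsilon> \<longrightarrow> \<epsilon> < 1 \<longrightarrow>
       A \<subseteq> carrier G \<longrightarrow> finite A \<longrightarrow> A \<noteq> {} \<longrightarrow>
       M \<subseteq> carrier G \<longrightarrow> finite M \<longrightarrow> M \<noteq> {} \<longrightarrow>
       L \<subseteq> carrier G \<longrightarrow> finite L \<longrightarrow> L \<noteq> {} \<longrightarrow>
       S \<subseteq> carrier G \<longrightarrow> finite S \<longrightarrow> S \<noteq> {} \<longrightarrow>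
       real (card (A <#>\<^bsub>G\<^esub> S)) \<le> K * real (card A) \<longrightarrow>
       \<eta> = real (card M) / real (card L) \<longrightarrow> \<eta> \<le> 1 \<longrightarrow>
       (\<exists>T \<subseteq> S.
          real (card T) \<ge>
            exp (- (C * (real k)\<^sup>2 * (1 / \<epsilon>\<^sup>2) * ln (2 / \<eta>) * ln (2 * K))) * real (card S) \<and>
          (\<forall>t \<in> iterated_difference_set G k T.
             let F = conv G (conv G (indicator A) (indicator M)) (indicator L)
             in sup_norm G (\<lambda>x. F (x \<otimes>\<^bsub>G\<^esub> t) - F x)
                  \<le> \<epsilon> * real (card A) * real (card M))))"

end

theory Submission imports Defs begin

text \<open>
  The argument is Croot and Sisask's: for a random \<open>m\<close>-tuple of elements of \<open>A\<close>, the average of the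
  translates \<open>1\<^sub>M * 1\<^sub>L(\<cdot> - a\<^sub>i)\<close> is with probability at least \<open>1/2\<close> uniformly close to
  \<open>1\<^sub>A * 1\<^sub>M * 1\<^sub>L / |A|\<close>. Translating the good tuples diagonally by \<open>S\<close> keeps them in
  \<open>(A + S)\<^sup>m\<close>, a set of size at most \<open>K\<^sup>m |A|\<^sup>m\<close>, so some tuple \<open>b\<close> is a translate of good ones by
  at least \<open>|S| / (2 K\<^sup>m)\<close> elements of \<open>S\<close>. The average along \<open>b\<close> is then close to all of
  the corresponding translates of \<open>1\<^sub>A * 1\<^sub>M * 1\<^sub>L\<close>, hence these are close to each other. The uniform
  approximation comes from exponential moments and Jensen's inequality, in place of the usual \<open>L\<^sup>p\<close>
  estimate and Hoelder's inequality; \<open>m\<close> of order \<open>k\<^sup>2 \<epsilon>\<^sup>-\<^sup>2 log (2/\<eta>)\<close> suffices for it.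
\<close>

section \<open>Uniform approximation by sampling\<close>

lemma exp_le_quadratic:
  fixes u :: real
  assumes "\<bar>u\<bar> \<le> 1"
  shows "exp u \<le> 1 + u + u\<^sup>2"
proof (cases "u \<ge> 0")
  case True
  then show ?thesis using exp_bound[of u] assms by auto
next
  case False
  define v where "v = - u"
  have v: "0 \<le> v" "v \<le> 1" using False assms by (auto simp: v_def)
  \<comment> \<open>For negative \<open>u\<close> the claim is proved in reciprocal form: the
    product of the desired bound with a Taylor lower bound for \<open>exp v\<close> is at least
    1.\<close>
  have "1 \<le> (1 - v + v\<^sup>2) * (1 + v + v\<^sup>2 / 2)"
  proof -
    have "(1 - v + v\<^sup>2) * (1 + v + v\<^sup>2 / 2) = 1 + v\<^sup>2 / 2 + v ^ 3 / 2 + v ^ 4 / 2"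
      by (simp add: field_simps power2_eq_square power3_eq_cube power4_eq_xxxx)
    then show ?thesis using v by simp
  qed
  also have "\<dots> \<le> (1 - v + v\<^sup>2) * exp v"
    using v exp_lower_Taylor_quadratic[of v] by (intro mult_left_mono) auto
  finally have "exp (- v) \<le> 1 - v + v\<^sup>2"
    by (simp add: exp_minus field_simps)
  then show ?thesis by (simp add: v_def)
qed

text \<open>Convexity of \<open>exp\<close> between 0 and \<open>z\<close>, obtained from the
  tangent at \<open>\<mu> * z\<close>. It pulls a mean \<open>\<mu>\<close> out of an exponential,
  so that moment bounds become linear in \<open>\<mu>\<close> and can be summed.\<close>

lemma exp_scale_minus_one_le:
  fixes \<mu> z :: real
  assumes "0 \<le> \<mu>" "\<mu> \<le> 1"
  shows "exp (\<mu> * z) - 1 \<le> \<mu> * (exp z - 1)"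
proof -
  define c where "c = \<mu> * z"
  have tangent: "exp c * (1 + (u - c)) \<le> exp u" for u
    using mult_left_mono[OF exp_ge_add_one_self[of "u - c"], of "exp c"]
    by (simp flip: exp_add)
  have "\<mu> * (exp c * (1 + (z - c))) + (1 - \<mu>) * (exp c * (1 + (0 - c)))
      \<le> \<mu> * exp z + (1 - \<mu>) * exp 0"
    using assms by (intro add_mono mult_left_mono tangent) auto
  also have "\<mu> * (exp c * (1 + (z - c))) + (1 - \<mu>) * (exp c * (1 + (0 - c))) = exp c"
    by (simp add: c_def algebra_simps)
  finally show ?thesis by (simp add: c_def algebra_simps)
qed

text \<open>Jensen's inequality: when the tangent line of \<open>exp\<close> at the mean
  \<open>c\<close> is summed over \<open>Y\<close>, the linear terms cancel.\<close>

lemma exp_mean_le: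
  fixes u :: "'a \<Rightarrow> real"
  assumes "finite Y" "Y \<noteq> {}"
  shows "real (card Y) * exp ((\<Sum>y\<in>Y. u y) / card Y) \<le> (\<Sum>y\<in>Y. exp (u y))"
proof -
  define c where "c = (\<Sum>y\<in>Y. u y) / card Y"
  have "exp c * (1 + (v - c)) \<le> exp v" for v
    using mult_left_mono[OF exp_ge_add_one_self[of "v - c"], of "exp c"]
    by (simp flip: exp_add)
  then have "(\<Sum>y\<in>Y. exp c * (1 + (u y - c))) \<le> (\<Sum>y\<in>Y. exp (u y))"
    by (intro sum_mono)
  moreover have "(\<Sum>y\<in>Y. exp c * (1 + (u y - c))) = card Y * exp c"
    using assms by (simp add: c_def sum_subtractf sum.distrib flip: sum_distrib_left)
  ultimately show ?thesis by (simp add: c_def)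
qed

lemma cosh_mean_le:
  fixes u :: "'a \<Rightarrow> real"
  assumes "finite Y" "Y \<noteq> {}"
  shows "real (card Y) * cosh ((\<Sum>y\<in>Y. u y) / card Y) \<le> (\<Sum>y\<in>Y. cosh (u y))"
  using exp_mean_le[OF assms, of u] exp_mean_le[OF assms, of "\<lambda>y. - u y"]
  by (simp add: cosh_def sum_negf sum.distrib field_simps flip: sum_divide_distrib)

lemma exp_abs_le_cosh: "exp \<bar>u\<bar> \<le> 2 * cosh (u :: real)"
  by (auto simp: cosh_def abs_if)

section \<open>Moments of a centred random sample\<close>

text \<open>Centring kills the linear term, and since a number in [0,1] dominates its square, the
  variance is at most the mean. The excess over \<open>card A\<close> is thus proportional to
  \<open>\<mu>\<close>, which later allows summation over all points.\<close>

lemma centred_exp_moment: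
  fixes f :: "'a \<Rightarrow> real" and \<mu> l :: real
  assumes A: "finite A" "A \<noteq> {}" and f: "\<And>a. a \<in> A \<Longrightarrow> 0 \<le> f a \<and> f a \<le> 1"
    and \<mu>: "\<mu> = (\<Sum>a\<in>A. f a) / card A" and l: "\<bar>l\<bar> \<le> 1"
  shows "(\<Sum>a\<in>A. exp (l * (f a - \<mu>))) \<le> card A * (1 + l\<^sup>2 * \<mu>)"
proof -
  have cA: "real (card A) > 0" using A by (simp add: card_gt_0_iff)
  have sf: "(\<Sum>a\<in>A. f a) = card A * \<mu>" using cA by (simp add: \<mu>)
  have \<mu>0: "0 \<le> \<mu>" using f by (auto simp: \<mu> intro!: divide_nonneg_nonneg sum_nonneg)
  have "(\<Sum>a\<in>A. f a) \<le> card A" using f sum_bounded_above[of A f 1] by simp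
  then have \<mu>1: "\<mu> \<le> 1" using cA by (simp add: \<mu> field_simps)
  have "(\<Sum>a\<in>A. exp (l * (f a - \<mu>))) \<le> (\<Sum>a\<in>A. 1 + l * (f a - \<mu>) + l\<^sup>2 * (f a - 2 * \<mu> * f a + \<mu>\<^sup>2))"
  proof (intro sum_mono)
    fix a assume a: "a \<in> A"
    have "\<bar>f a - \<mu>\<bar> \<le> 1" using f[OF a] \<mu>0 \<mu>1 by linarith
    then have "\<bar>l * (f a - \<mu>)\<bar> \<le> 1" using l by (simp add: abs_mult mult_le_one)
    then have "exp (l * (f a - \<mu>)) \<le> 1 + l * (f a - \<mu>) + l\<^sup>2 * (f a - \<mu>)\<^sup>2"
      using exp_le_quadratic by (metis power_mult_distrib)
    also have "(f a - \<mu>)\<^sup>2 \<le> f a - 2 * \<mu> * f a + \<mu>\<^sup>2"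
      using f[OF a] mult_left_le[of "f a" "f a"] by (simp add: power2_eq_square algebra_simps)
    finally show "exp (l * (f a - \<mu>)) \<le> 1 + l * (f a - \<mu>) + l\<^sup>2 * (f a - 2 * \<mu> * f a + \<mu>\<^sup>2)"
      by (simp add: mult_left_mono)
  qed
  also have "\<dots> = card A + l * ((\<Sum>a\<in>A. f a) - card A * \<mu>)
      + l\<^sup>2 * ((\<Sum>a\<in>A. f a) - 2 * \<mu> * (\<Sum>a\<in>A. f a) + card A * \<mu>\<^sup>2)"
    by (simp add: sum.distrib sum_subtractf flip: sum_distrib_left)
  also have "\<dots> = card A * (1 + l\<^sup>2 * \<mu>) - card A * l\<^sup>2 * \<mu>\<^sup>2"
    by (simp add: sf algebra_simps power2_eq_square)
  also have "\<dots> \<le> card A * (1 + l\<^sup>2 * \<mu>)" by simp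
  finally show ?thesis .
qed

text \<open>The coordinates of a tuple are independent, so the sum over tuples factors into
  \<open>m\<close> one-variable moments; the two signs of \<open>l\<close> average to
  \<open>cosh\<close>. Subtracting 1 leaves a bound linear in \<open>\<mu>\<close>.\<close>

lemma centred_cosh_moment:
  fixes f :: "'a \<Rightarrow> real" and \<mu> l :: real
  assumes A: "finite A" "A \<noteq> {}" and f: "\<And>a. a \<in> A \<Longrightarrow> 0 \<le> f a \<and> f a \<le> 1"
    and \<mu>: "\<mu> = (\<Sum>a\<in>A. f a) / card A" and l: "\<bar>l\<bar> \<le> 1"
  shows "(\<Sum>a\<in>PiE {..<m} (\<lambda>_. A). cosh (l * (\<Sum>i<m. f (a i) - \<mu>)) - 1)
    \<le> card A ^ m * \<mu> * (exp (l\<^sup>2 * m) - 1)"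
proof -
  have cA: "real (card A) > 0" using A by (simp add: card_gt_0_iff)
  have \<mu>0: "0 \<le> \<mu>" using f by (auto simp: \<mu> intro!: divide_nonneg_nonneg sum_nonneg)
  have "(\<Sum>a\<in>A. f a) \<le> card A" using f sum_bounded_above[of A f 1] by simp
  then have \<mu>1: "\<mu> \<le> 1" using cA by (simp add: \<mu> field_simps)
  let ?P = "PiE {..<m} (\<lambda>_. A)"
  have cP: "card ?P = card A ^ m" by (simp add: card_PiE)
  have *: "(\<Sum>a\<in>?P. exp (l' * (\<Sum>i<m. f (a i) - \<mu>)) - 1) \<le> card A ^ m * \<mu> * (exp (l\<^sup>2 * m) - 1)"
    if "l' = l \<or> l' = - l" for l'
  proof -
    have l': "\<bar>l'\<bar> \<le> 1" "l'\<^sup>2 = l\<^sup>2" using that l by auto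
    have "(\<Sum>a\<in>?P. exp (l' * (\<Sum>i<m. f (a i) - \<mu>)))
        = (\<Sum>a\<in>?P. \<Prod>i<m. exp (l' * (f (a i) - \<mu>)))"
      by (simp add: sum_distrib_left exp_sum)
    also have "\<dots> = (\<Prod>i<m. \<Sum>a\<in>A. exp (l' * (f a - \<mu>)))"
      using A by (subst prod_sum_PiE) auto
    also have "\<dots> \<le> (card A * (1 + l\<^sup>2 * \<mu>)) ^ m"
      using centred_exp_moment[OF A f \<mu> l'(1)] l' by (simp add: power_mono sum_nonneg)
    also have "\<dots> \<le> (card A * exp (l\<^sup>2 * \<mu>)) ^ m"
      using \<mu>0 by (intro power_mono mult_left_mono exp_ge_add_one_self) auto
    also have "\<dots> = card A ^ m * exp (\<mu> * (l\<^sup>2 * m))"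
      by (simp add: power_mult_distrib mult_ac flip: exp_of_nat_mult)
    finally have "(\<Sum>a\<in>?P. exp (l' * (\<Sum>i<m. f (a i) - \<mu>)) - 1) \<le> card A ^ m * (exp (\<mu> * (l\<^sup>2 * m)) - 1)"
      by (simp add: sum_subtractf cP algebra_simps)
    also have "\<dots> \<le> card A ^ m * (\<mu> * (exp (l\<^sup>2 * m) - 1))"
      using \<mu>0 \<mu>1 by (intro mult_left_mono exp_scale_minus_one_le) auto
    finally show ?thesis by (simp add: mult_ac)
  qed
  have "(\<Sum>a\<in>?P. cosh (l * (\<Sum>i<m. f (a i) - \<mu>)) - 1)
    = ((\<Sum>a\<in>?P. exp (l * (\<Sum>i<m. f (a i) - \<mu>)) - 1) + (\<Sum>a\<in>?P. exp (- l * (\<Sum>i<m. f (a i) - \<mu>)) - 1)) / 2"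
    unfolding sum.distrib[symmetric] sum_divide_distrib
    by (intro sum.cong refl) (simp add: cosh_def field_simps)
  then show ?thesis using *[of l] *[of "- l"] by simp
qed

text \<open>Markov's inequality for the uniform measure on \<open>P\<close>, obtained by counting
  the bad points.\<close>

lemma markov_half:
  fixes g :: "'a \<Rightarrow> real" and c :: real
  assumes P: "finite P" and g: "\<And>a. a \<in> P \<Longrightarrow> 0 \<le> g a" and c: "0 < c"
    and sum: "(\<Sum>a\<in>P. g a) \<le> card P * c"
  shows "card P \<le> 2 * card {a \<in> P. g a \<le> 2 * c}"
proof -
  let ?B = "{a \<in> P. \<not> g a \<le> 2 * c}"
  have "card ?B * (2 * c) \<le> (\<Sum>a\<in>?B. g a)"
    using sum_bounded_below[of ?B "2 * c" g] by auto
  also have "\<dots> \<le> (\<Sum>a\<in>P. g a)" using P g by (intro sum_mono2) auto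
  finally have "card ?B * (2 * c) \<le> card P * c" using sum by linarith
  then have "real (card ?B * 2) \<le> real (card P)" using c by simp
  then have "card ?B * 2 \<le> card P" unfolding of_nat_le_iff .
  moreover have "card P = card {a \<in> P. g a \<le> 2 * c} + card ?B"
    using P by (subst card_Un_disjoint[symmetric]) (auto intro!: arg_cong[where f = card])
  ultimately show ?thesis by linarith
qed

text \<open>
  For a sample \<open>a\<close> put \<open>D y = (\<Sum>i<m. f y (a i) - \<mu> y)\<close>. As
  \<open>cosh - 1\<close> vanishes at \<open>0\<close>, its moments can be summed over all \<open>y\<close>, so that Markov's
  inequality controls \<open>\<Sum>y. cosh (l * D y) - 1\<close> once and for all. Jensen's inequality then
  bounds the mean of \<open>D\<close> over every \<open>n\<close>-element set \<open>Y\<close> simultaneously, without a union bound.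
\<close>

lemma many_samples_approximate:
  fixes f :: "'b \<Rightarrow> 'a \<Rightarrow> real" and L \<delta> :: real
  assumes A: "finite A" "A \<noteq> {}" and B: "finite B"
    and f: "\<And>y a. a \<in> A \<Longrightarrow> 0 \<le> f y a \<and> f y a \<le> 1"
    and f0: "\<And>y a. a \<in> A \<Longrightarrow> y \<notin> B \<Longrightarrow> f y a = 0"
    and fsum: "\<And>a. a \<in> A \<Longrightarrow> (\<Sum>y\<in>B. f y a) \<le> L"
    and n: "0 < n" "real n \<le> L" and \<delta>: "0 < \<delta>" "\<delta> \<le> 1"
    and m: "4 * ln (4 * L / n) \<le> \<delta>\<^sup>2 * m"
  shows "card A ^ m \<le> 2 * card {a \<in> PiE {..<m} (\<lambda>_. A). \<forall>Y. finite Y \<longrightarrow> card Y = n \<longrightarrow>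
    \<bar>(\<Sum>y\<in>Y. \<Sum>i<m. f y (a i)) - m / card A * (\<Sum>y\<in>Y. \<Sum>a\<in>A. f y a)\<bar> \<le> \<delta> * m * n}"
    (is "_ \<le> 2 * card ?good")
proof -
  let ?P = "PiE {..<m} (\<lambda>_. A)"
  define \<mu> where "\<mu> y = (\<Sum>a\<in>A. f y a) / card A" for y
  \<comment> \<open>The estimate of \<open>\<bar>v\<bar>\<close> below needs
    \<open>ln (4 * L / n) \<le> (l * \<delta> - l\<^sup>2) * m\<close>. This \<open>l\<close>
    maximises the right-hand side; its value \<open>\<delta>\<^sup>2 * m / 4\<close> is what the
    assumption on \<open>m\<close> supplies.\<close>
  define l where "l = \<delta> / 2"
  define D where "D a y = (\<Sum>i<m. f y (a i) - \<mu> y)" for a y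
  define g where "g a = (\<Sum>y\<in>B. cosh (l * D a y) - 1)" for a
  define z where "z = l\<^sup>2 * m"
  have cA: "real (card A) > 0" using A by (simp add: card_gt_0_iff)
  have L: "L > 0" using n by linarith
  \<comment> \<open>Positivity of the logarithm, from \<open>n \<le> L\<close>, forces
    \<open>m > 0\<close>; this makes the constant handed to Markov's inequality positive.\<close>
  have "ln (4 * L / n) > 0" using n by (intro ln_gt_zero) (simp add: field_simps)
  then have m0: "m > 0" using m by (cases m) auto
  have l: "0 < l" "\<bar>l\<bar> \<le> 1" using \<delta> by (auto simp: l_def)
  have z: "z > 0" using l m0 by (simp add: z_def)
  have cP: "card ?P = card A ^ m" by (simp add: card_PiE)
  have finP: "finite ?P" using A by (intro finite_PiE) auto
  have g0: "0 \<le> g a" for a by (auto simp: g_def cosh_real_ge_1 intro!: sum_nonneg)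
  have "(\<Sum>y\<in>B. \<mu> y) = (\<Sum>a\<in>A. \<Sum>y\<in>B. f y a) / card A"
    unfolding \<mu>_def sum_divide_distrib[symmetric] by (subst sum.swap) simp
  also have "\<dots> \<le> (card A * L) / card A"
    using fsum sum_bounded_above[of A "\<lambda>a. \<Sum>y\<in>B. f y a" L] by (intro divide_right_mono) auto
  finally have \<mu>sum: "(\<Sum>y\<in>B. \<mu> y) \<le> L" using cA by simp
  have "(\<Sum>a\<in>?P. g a) = (\<Sum>y\<in>B. \<Sum>a\<in>?P. cosh (l * D a y) - 1)"
    unfolding g_def by (rule sum.swap)
  also have "\<dots> \<le> (\<Sum>y\<in>B. card A ^ m * \<mu> y * (exp z - 1))"
    unfolding D_def z_def using A f l by (intro sum_mono centred_cosh_moment) (simp_all add: \<mu>_def)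
  also have "\<dots> = (card A ^ m * (exp z - 1)) * (\<Sum>y\<in>B. \<mu> y)"
    unfolding sum_distrib_left by (simp add: mult_ac)
  also have "\<dots> \<le> (card A ^ m * (exp z - 1)) * L"
    using \<mu>sum z by (intro mult_left_mono) auto
  finally have "(\<Sum>a\<in>?P. g a) \<le> card ?P * (L * (exp z - 1))" by (simp add: cP mult_ac)
  then have "card ?P \<le> 2 * card {a \<in> ?P. g a \<le> 2 * (L * (exp z - 1))}"
    using finP g0 L z by (intro markov_half) auto
  moreover have "{a \<in> ?P. g a \<le> 2 * (L * (exp z - 1))} \<subseteq> ?good"
  proof safe
    fix a and Y :: "'b set"
    assume a: "a \<in> ?P" and ga: "g a \<le> 2 * (L * (exp z - 1))" and Y: "finite Y" and nY: "n = card Y"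
    define v where "v = l * (\<Sum>y\<in>Y. D a y) / n"
    \<comment> \<open>Outside \<open>B\<close> every \<open>f y\<close> vanishes on
      \<open>A\<close>, so the test set \<open>Y\<close> need not lie in \<open>B\<close>.\<close>
    have D0: "D a y = 0" if "y \<notin> B" for y
      using that f0 a by (auto simp: D_def \<mu>_def PiE_iff intro!: sum.neutral)
    have Y0: "Y \<noteq> {}" using n nY by auto
    have "real n * cosh v - n \<le> (\<Sum>y\<in>Y. cosh (l * D a y)) - n"
      using cosh_mean_le[OF Y Y0, of "\<lambda>y. l * D a y"]
      by (simp add: v_def nY flip: sum_distrib_left)
    also have "\<dots> = (\<Sum>y\<in>Y. cosh (l * D a y) - 1)" by (simp add: sum_subtractf nY)
    also have "\<dots> = (\<Sum>y\<in>Y \<inter> B. cosh (l * D a y) - 1)"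
      using Y D0 by (intro sum.mono_neutral_right) auto
    also have "\<dots> \<le> g a" unfolding g_def
      using B by (intro sum_mono2) (auto simp: cosh_real_ge_1)
    \<comment> \<open>The leftover terms \<open>n\<close> and \<open>- 2 * L\<close> have a negative
      sum because \<open>n \<le> L\<close>, and are dropped together.\<close>
    finally have "real n * cosh v \<le> 2 * L * exp z" using ga n by (simp add: algebra_simps)
    then have "cosh v \<le> 2 * L / n * exp z" using n by (simp add: field_simps)
    then have "exp \<bar>v\<bar> \<le> 4 * L / n * exp z" using exp_abs_le_cosh[of v] by simp
    then have "\<bar>v\<bar> \<le> ln (4 * L / n * exp z)" using L n by (subst ln_ge_iff) auto
    also have "\<dots> = ln (4 * L / n) + z" using L n by (subst ln_mult) auto
    also have "\<dots> \<le> l * \<delta> * m" using m by (simp add: l_def z_def power2_eq_square)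
    finally have "l * (\<bar>\<Sum>y\<in>Y. D a y\<bar> / n) \<le> l * (\<delta> * m)"
      using l by (simp add: v_def abs_mult mult_ac)
    then have "\<bar>\<Sum>y\<in>Y. D a y\<bar> \<le> \<delta> * m * n" using l n by (simp add: field_simps)
    moreover have "(\<Sum>y\<in>Y. D a y) = (\<Sum>y\<in>Y. \<Sum>i<m. f y (a i)) - m / card A * (\<Sum>y\<in>Y. \<Sum>a\<in>A. f y a)"
      by (simp add: D_def \<mu>_def sum_subtractf sum_distrib_left sum_divide_distrib)
    ultimately show "\<bar>(\<Sum>y\<in>Y. \<Sum>i<m. f y (a i)) - m / card A * (\<Sum>y\<in>Y. \<Sum>a\<in>A. f y a)\<bar> \<le> \<delta> * m * card Y"
      by (simp add: nY)
  qed
  ultimately show ?thesis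
    using card_mono[of ?good "{a \<in> ?P. g a \<le> 2 * (L * (exp z - 1))}"] finP cP by fastforce
qed

section \<open>Almost periods of triple convolutions\<close>

lemma conv_eq_sum:
  assumes "finite B" "B \<subseteq> carrier G" "\<And>y. y \<in> carrier G \<Longrightarrow> y \<notin> B \<Longrightarrow> f y = 0"
  shows "conv G f g x = (\<Sum>y\<in>B. f y * g (x \<otimes>\<^bsub>G\<^esub> inv\<^bsub>G\<^esub> y))"
  unfolding conv_def using assms by (intro sum.mono_neutral_left) auto

text \<open>The number of pairs \<open>(a, z)\<close> for which the quotient of \<open>x\<close> by
  \<open>a\<close> and \<open>z\<close> lies in \<open>L\<close>. As a finite real sum it involves
  neither supports nor complex values.\<close>

definition triple_conv ::
  "('a, 'b) monoid_scheme \<Rightarrow> 'a set \<Rightarrow> 'a set \<Rightarrow> 'a set \<Rightarrow> 'a \<Rightarrow> real" where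
  "triple_conv G A M L x =
    (\<Sum>a\<in>A. \<Sum>z\<in>M. indicator L (x \<otimes>\<^bsub>G\<^esub> inv\<^bsub>G\<^esub> a \<otimes>\<^bsub>G\<^esub> inv\<^bsub>G\<^esub> z))"

lemma finite_set_mult: "finite A \<Longrightarrow> finite B \<Longrightarrow> finite (A <#>\<^bsub>G\<^esub> B)"
  unfolding set_mult_def by blast

context comm_group
begin

lemma mult_divide_cancel: "a \<in> carrier G \<Longrightarrow> y \<in> carrier G \<Longrightarrow> a \<otimes> (y \<otimes> inv a) = y"
  by (simp add: m_lcomm[of a y])

lemma conv_indicator_indicator:
  assumes A: "finite A" "A \<subseteq> carrier G"
  shows "conv G (indicator A) (indicator M) y = (\<Sum>a\<in>A. indicator M (y \<otimes> inv a))"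
  using assms by (subst conv_eq_sum[where B = A]) (auto simp: indicator_def intro!: sum.cong)

text \<open>For each \<open>a\<close> only the \<open>y\<close> in the translate of \<open>M\<close>
  by \<open>a\<close> contribute, and substituting \<open>y = a \<otimes> z\<close> turns the sum
  over \<open>A <#> M\<close> into one over \<open>M\<close>.\<close>

lemma conv_conv_indicator:
  assumes A: "finite A" "A \<subseteq> carrier G" and M: "finite M" "M \<subseteq> carrier G" and x: "x \<in> carrier G"
  shows "conv G (conv G (indicator A) (indicator M)) (indicator L) x = of_real (triple_conv G A M L x)"
proof -
  let ?B = "A <#> M"
  have B: "finite ?B" "?B \<subseteq> carrier G" using A M by (auto intro: finite_set_mult simp: set_mult_closed)
  have *: "y \<in> ?B" if "a \<in> A" "y \<in> carrier G" "y \<otimes> inv a \<in> M" for a y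
  proof -
    have "y = a \<otimes> (y \<otimes> inv a)" using that A by (auto simp: mult_divide_cancel)
    then show ?thesis using that by (auto simp: set_mult_def)
  qed
  have "conv G (conv G (indicator A) (indicator M)) (indicator L) x
      = (\<Sum>y\<in>?B. (\<Sum>a\<in>A. indicator M (y \<otimes> inv a)) * indicator L (x \<otimes> inv y))"
    using A B * by (subst conv_eq_sum[where B = ?B])
      (auto simp: conv_indicator_indicator indicator_def intro!: sum.neutral)
  also have "\<dots> = (\<Sum>a\<in>A. \<Sum>y\<in>?B. indicator M (y \<otimes> inv a) * indicator L (x \<otimes> inv y))"
    unfolding sum_distrib_right by (rule sum.swap)
  also have "\<dots> = (\<Sum>a\<in>A. \<Sum>z\<in>M. indicator L (x \<otimes> inv a \<otimes> inv z))"
  proof (rule sum.cong[OF refl])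
    fix a assume a: "a \<in> A"
    then have ac: "a \<in> carrier G" using A by auto
    have "(\<Sum>y\<in>?B. indicator M (y \<otimes> inv a) * indicator L (x \<otimes> inv y))
        = (\<Sum>y\<in>(\<otimes>) a ` M. indicator M (y \<otimes> inv a) * indicator L (x \<otimes> inv y) :: complex)"
    proof (intro sum.mono_neutral_right ballI)
      fix y assume y: "y \<in> ?B - (\<otimes>) a ` M"
      have "y \<otimes> inv a \<notin> M"
      proof
        assume yM: "y \<otimes> inv a \<in> M"
        have "y = a \<otimes> (y \<otimes> inv a)"
          using y B ac by (auto simp: mult_divide_cancel)
        then show False using yM y by blast
      qed
      then show "indicator M (y \<otimes> inv a) * indicator L (x \<otimes> inv y) = (0 :: complex)" by simp
    qed (use a B in \<open>auto simp: set_mult_def\<close>)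
    also have "\<dots> = (\<Sum>z\<in>M. indicator M (a \<otimes> z \<otimes> inv a) * indicator L (x \<otimes> inv (a \<otimes> z)))"
      using M ac by (subst sum.reindex) (auto simp: inj_on_def subset_eq)
    also have "\<dots> = (\<Sum>z\<in>M. indicator L (x \<otimes> inv a \<otimes> inv z))"
    proof (intro sum.cong refl)
      fix z assume z: "z \<in> M"
      then have zc: "z \<in> carrier G" using M by auto
      have "a \<otimes> z \<otimes> inv a = z" using ac zc by (simp add: m_assoc mult_divide_cancel)
      moreover have "x \<otimes> inv (a \<otimes> z) = x \<otimes> inv a \<otimes> inv z"
        using ac zc x by (simp add: inv_mult m_assoc)
      ultimately show "indicator M (a \<otimes> z \<otimes> inv a) * indicator L (x \<otimes> inv (a \<otimes> z))
          = (indicator L (x \<otimes> inv a \<otimes> inv z) :: complex)" using z by simp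
    qed
    finally show "(\<Sum>y\<in>?B. indicator M (y \<otimes> inv a) * indicator L (x \<otimes> inv y))
        = (\<Sum>z\<in>M. indicator L (x \<otimes> inv a \<otimes> inv z) :: complex)" .
  qed
  also have "\<dots> = of_real (triple_conv G A M L x)"
    by (simp add: triple_conv_def indicator_def of_bool_def if_distrib[where f = of_real] cong: if_cong)
  finally show ?thesis .
qed

text \<open>A nonzero term would exhibit \<open>x\<close> as a product of elements of
  \<open>N\<close>. This handles the points outside the image of an embedding.\<close>

lemma triple_conv_eq_0:
  assumes "subgroup N G" "A \<subseteq> N" "M \<subseteq> N" "L \<subseteq> N" "x \<in> carrier G" "x \<notin> N"
  shows "triple_conv G A M L x = 0"
proof -
  have "x \<otimes> inv a \<otimes> inv z \<notin> L" if "a \<in> A" "z \<in> M" for a z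
  proof
    assume l: "x \<otimes> inv a \<otimes> inv z \<in> L"
    have N: "N \<subseteq> carrier G" using assms(1) by (rule subgroup.subset)
    have mem: "a \<in> N" "z \<in> N" "x \<otimes> inv a \<otimes> inv z \<in> N" using l that assms by auto
    then have "(x \<otimes> inv a \<otimes> inv z) \<otimes> z \<otimes> a \<in> N" using assms(1) by (simp add: subgroup.m_closed)
    also have "(x \<otimes> inv a \<otimes> inv z) \<otimes> z \<otimes> a = x"
      using mem N assms(5) by (simp add: m_assoc subset_eq)
    finally show False using assms by simp
  qed
  then show ?thesis by (simp add: triple_conv_def)
qed

lemma triple_conv_finite_support:
  assumes "finite A" "A \<subseteq> carrier G" "finite M" "M \<subseteq> carrier G" "finite L"
  shows "finite {x \<in> carrier G. triple_conv G A M L x \<noteq> 0}"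
proof (rule finite_subset)
  show "{x \<in> carrier G. triple_conv G A M L x \<noteq> 0} \<subseteq> L <#> M <#> A"
  proof safe
    fix x assume x: "x \<in> carrier G" and "triple_conv G A M L x \<noteq> 0"
    then obtain a z where az: "a \<in> A" "z \<in> M" and l: "x \<otimes> inv a \<otimes> inv z \<in> L"
      unfolding triple_conv_def by (metis (no_types, lifting) indicator_simps(2) sum.neutral)
    then have "x = (x \<otimes> inv a \<otimes> inv z) \<otimes> z \<otimes> a"
      using x assms by (simp add: m_assoc subset_eq)
    then show "x \<in> L <#> M <#> A" using az l unfolding set_mult_def by blast
  qed
qed (use assms in \<open>simp add: finite_set_mult\<close>)

text \<open>\<open>Max\<close> has its intended meaning only on finite sets. The triple convolution
  has finite support, so it takes finitely many values, and so do the differences of its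
  values.\<close>

lemma sup_norm_conv_le_iff:
  fixes A M L :: "'a set"
  defines "F \<equiv> conv G (conv G (indicator A) (indicator M)) (indicator L)"
  assumes A: "finite A" "A \<subseteq> carrier G" and M: "finite M" "M \<subseteq> carrier G" and L: "finite L"
    and t: "t \<in> carrier G"
  shows "sup_norm G (\<lambda>x. F (x \<otimes> t) - F x) \<le> c \<longleftrightarrow>
    (\<forall>x\<in>carrier G. \<bar>triple_conv G A M L (x \<otimes> t) - triple_conv G A M L x\<bar> \<le> c)"
proof -
  let ?r = "triple_conv G A M L"
  let ?V = "insert 0 (?r ` {x \<in> carrier G. ?r x \<noteq> 0})"
  have eq: "cmod (F (x \<otimes> t) - F x) = \<bar>?r (x \<otimes> t) - ?r x\<bar>" if "x \<in> carrier G" for x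
    using that A M t by (simp add: F_def conv_conv_indicator flip: of_real_diff)
  have "(\<lambda>x. cmod (F (x \<otimes> t) - F x)) ` carrier G \<subseteq> (\<lambda>(u, v). \<bar>u - v\<bar>) ` (?V \<times> ?V)"
  proof safe
    fix x assume x: "x \<in> carrier G"
    have "?r y \<in> ?V" if "y \<in> carrier G" for y using that by auto
    then have "(?r (x \<otimes> t), ?r x) \<in> ?V \<times> ?V" using x t by blast
    then show "cmod (F (x \<otimes> t) - F x) \<in> (\<lambda>(u, v). \<bar>u - v\<bar>) ` (?V \<times> ?V)"
      unfolding eq[OF x] by force
  qed
  moreover have "finite ?V" using triple_conv_finite_support[OF A M L] by simp
  ultimately have "finite ((\<lambda>x. cmod (F (x \<otimes> t) - F x)) ` carrier G)"
    by (meson finite_SigmaI finite_imageI finite_subset)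
  then show ?thesis
    unfolding sup_norm_def using eq by (subst Max_le_iff) auto
qed

section \<open>Almost periods by double counting\<close>

text \<open>Diagonal translation by each \<open>s\<close> maps \<open>P\<close> injectively into the
  tuples over \<open>A <#> S\<close>. This gives at least \<open>card S * card P\<close> pairs
  \<open>(s, b)\<close>, and some \<open>b\<close> occurs in at least the average number of
  them.\<close>

lemma popular_translate:
  assumes I: "finite I" and A: "finite A" "A \<noteq> {}" "A \<subseteq> carrier G"
    and S: "finite S" "S \<noteq> {}" "S \<subseteq> carrier G" and P: "P \<subseteq> PiE I (\<lambda>_. A)"
  obtains b where "b \<in> PiE I (\<lambda>_. A <#> S)"
    "card S * card P \<le> card (A <#> S) ^ card I * card {s \<in> S. (\<lambda>i\<in>I. b i \<otimes> inv s) \<in> P}"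
proof -
  let ?Q = "PiE I (\<lambda>_. A <#> S)"
  let ?R = "\<lambda>b s. (\<lambda>i\<in>I. b i \<otimes> inv s) \<in> P"
  have AS: "finite (A <#> S)" "A <#> S \<noteq> {}" using A S by (auto intro: finite_set_mult simp: set_mult_def)
  have Q: "finite ?Q" "?Q \<noteq> {}" using AS I by (auto simp: finite_PiE PiE_eq_empty_iff)
  have cQ: "card ?Q = card (A <#> S) ^ card I" using I by (simp add: card_PiE)
  have "card P \<le> card {b \<in> ?Q. ?R b s}" if s: "s \<in> S" for s
  proof (rule card_inj_on_le[where f = "\<lambda>a. \<lambda>i\<in>I. a i \<otimes> s"])
    have untranslate: "(\<lambda>i\<in>I. (\<lambda>i\<in>I. a i \<otimes> s) i \<otimes> inv s) = a" if "a \<in> P" for a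
    proof
      fix i
      have a: "a \<in> PiE I (\<lambda>_. A)" using that P by auto
      show "(\<lambda>i\<in>I. (\<lambda>i\<in>I. a i \<otimes> s) i \<otimes> inv s) i = a i"
      proof (cases "i \<in> I")
        case True
        then have "a i \<in> carrier G" "s \<in> carrier G" using a s A S by (auto simp: PiE_iff)
        then show ?thesis using True by (simp add: m_assoc)
      qed (use a in \<open>simp add: PiE_arb[OF a]\<close>)
    qed
    then show "inj_on (\<lambda>a. \<lambda>i\<in>I. a i \<otimes> s) P"
      by (intro inj_on_inverseI[where g = "\<lambda>c. \<lambda>i\<in>I. c i \<otimes> inv s"]) simp
    show "(\<lambda>a. \<lambda>i\<in>I. a i \<otimes> s) ` P \<subseteq> {b \<in> ?Q. ?R b s}"
    proof (rule image_subsetI)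
      fix a assume a: "a \<in> P"
      have "(\<lambda>i\<in>I. a i \<otimes> s) \<in> ?Q"
        using a P s by (auto simp: set_mult_def PiE_iff subset_eq)
      moreover have "?R (\<lambda>i\<in>I. a i \<otimes> s) s" using untranslate[OF a] a by simp
      ultimately show "(\<lambda>i\<in>I. a i \<otimes> s) \<in> {b \<in> ?Q. ?R b s}" by blast
    qed
    show "finite {b \<in> ?Q. ?R b s}" using Q by simp
  qed
  then have "card S * card P \<le> (\<Sum>s\<in>S. card {b \<in> ?Q. ?R b s})"
    using sum_bounded_below[of S "card P"] by simp
  also have "\<dots> = (\<Sum>b\<in>?Q. card {s \<in> S. ?R b s})"
    using sum_multicount_gen[of ?Q S ?R "\<lambda>s. card {b \<in> ?Q. ?R b s}"] Q S by simp
  finally have le: "card S * card P \<le> (\<Sum>b\<in>?Q. card {s \<in> S. ?R b s})" .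
  have "\<exists>b\<in>?Q. card S * card P \<le> card ?Q * card {s \<in> S. ?R b s}"
  proof (rule ccontr)
    assume "\<not> ?thesis"
    then have "(\<Sum>b\<in>?Q. card ?Q * card {s \<in> S. ?R b s}) < (\<Sum>b\<in>?Q. card S * card P)"
      using Q by (intro sum_strict_mono) auto
    then have "card ?Q * (\<Sum>b\<in>?Q. card {s \<in> S. ?R b s}) < card ?Q * (card S * card P)"
      by (simp add: sum_distrib_left)
    then show False using le by simp
  qed
  then show ?thesis using that unfolding cQ by blast
qed

text \<open>The triple convolution is a sum over \<open>A\<close> of translates of \<open>h\<close>.
  The sum of \<open>h\<close> along one popular tuple \<open>b\<close> approximates, up to scaling,
  the translates by all \<open>s\<close> in \<open>T\<close> at once, so these are close to each
  other.\<close>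

lemma many_almost_periods:
  fixes K \<delta> :: real
  assumes A: "finite A" "A \<noteq> {}" "A \<subseteq> carrier G" and M: "finite M" "M \<noteq> {}" "M \<subseteq> carrier G"
    and L: "finite L" "L \<subseteq> carrier G" and S: "finite S" "S \<noteq> {}" "S \<subseteq> carrier G"
    and K: "card (A <#> S) \<le> K * card A" and card_le: "card M \<le> card L"
    and \<delta>: "0 < \<delta>" "\<delta> \<le> 1" and m: "4 * ln (4 * card L / card M) \<le> \<delta>\<^sup>2 * m"
  obtains T where "T \<subseteq> S" "card S \<le> 2 * K ^ m * card T"
    "\<And>s s' x. s \<in> T \<Longrightarrow> s' \<in> T \<Longrightarrow> x \<in> carrier G \<Longrightarrow>
      \<bar>triple_conv G A M L (x \<otimes> s \<otimes> inv s') - triple_conv G A M L x\<bar> \<le> 2 * \<delta> * card A * card M"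
proof -
  define h where "h u = (\<Sum>z\<in>M. indicat_real L (u \<otimes> inv z))" for u
  define F where "F = triple_conv G A M L"
  have F: "F x = (\<Sum>a\<in>A. h (x \<otimes> inv a))" for x by (simp add: F_def triple_conv_def h_def)
  \<comment> \<open>Counting the points of the set \<open>Y x\<close> that lie in
    \<open>L #> a\<close> recovers \<open>h (x \<otimes> inv a)\<close>. The sampling lemma then
    applies with total mass at most \<open>card L\<close> and test sets of size
    \<open>card M\<close>, uniformly in \<open>x\<close>.\<close>
  define f where "f y a = indicat_real (L #> a) y" for y a
  have cA: "real (card A) > 0" and cM: "card M > 0" using A M by (simp_all add: card_gt_0_iff)
  have cosetL: "x \<otimes> inv z \<in> L #> a \<longleftrightarrow> x \<otimes> inv a \<otimes> inv z \<in> L"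
    if "x \<in> carrier G" "z \<in> carrier G" "a \<in> carrier G" for x z a
  proof -
    have eq: "x \<otimes> inv a \<otimes> inv z = x \<otimes> inv z \<otimes> inv a" using that by (simp add: m_ac)
    show ?thesis
    proof
      assume "x \<otimes> inv z \<in> L #> a"
      then obtain l where "l \<in> L" "x \<otimes> inv z = l \<otimes> a" by (auto simp: r_coset_def)
      then show "x \<otimes> inv a \<otimes> inv z \<in> L" using that L by (simp add: eq m_assoc subset_eq)
    next
      assume "x \<otimes> inv a \<otimes> inv z \<in> L"
      moreover have "x \<otimes> inv z = (x \<otimes> inv a \<otimes> inv z) \<otimes> a" using that by (simp add: eq m_assoc)
      ultimately show "x \<otimes> inv z \<in> L #> a" unfolding r_coset_def by blast
    qed
  qed
  define Y where "Y x = (\<lambda>z. x \<otimes> inv z) ` M" for x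
  have injY: "inj_on (\<lambda>z. x \<otimes> inv z) M" if "x \<in> carrier G" for x
    using that M by (auto simp: inj_on_def subset_eq)
  have sumY: "(\<Sum>y\<in>Y x. f y a) = h (x \<otimes> inv a)" if "x \<in> carrier G" "a \<in> carrier G" for x a
    unfolding Y_def h_def f_def using M that
    by (subst sum.reindex[OF injY]) (auto simp: indicator_def cosetL subset_eq intro!: sum.cong)
  define P where "P = {a \<in> PiE {..<m} (\<lambda>_. A). \<forall>Y. finite Y \<longrightarrow> card Y = card M \<longrightarrow>
    \<bar>(\<Sum>y\<in>Y. \<Sum>i<m. f y (a i)) - m / card A * (\<Sum>y\<in>Y. \<Sum>a\<in>A. f y a)\<bar> \<le> \<delta> * m * card M}"
  have cP: "card A ^ m \<le> 2 * card P"
    unfolding P_def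
  proof (rule many_samples_approximate[where B = "L <#> A" and L = "card L"])
    show "f y a = 0" if "a \<in> A" "y \<notin> L <#> A" for y a
      using that by (auto simp: f_def r_coset_def set_mult_def indicator_def)
    show "(\<Sum>y\<in>L <#> A. f y a) \<le> card L" if a: "a \<in> A" for a
    proof -
      have "(\<Sum>y\<in>L <#> A. f y a) = (\<Sum>y\<in>(L <#> A) \<inter> (L #> a). f y a)"
        using A L by (intro sum.mono_neutral_right) (auto simp: f_def finite_set_mult)
      also have "\<dots> = card ((L <#> A) \<inter> (L #> a))" by (simp add: f_def)
      also have "\<dots> \<le> card (L #> a)"
        using L by (auto simp: r_coset_def intro!: card_mono)
      also have "L #> a = (\<lambda>l. l \<otimes> a) ` L" by (auto simp: r_coset_def)
      also have "card \<dots> \<le> card L" using L by (intro card_image_le)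
      finally show ?thesis by simp
    qed
  qed (use A L card_le \<delta> m cM in \<open>auto simp: f_def indicator_def finite_set_mult\<close>)
  have approx: "\<bar>(\<Sum>i<m. h (x \<otimes> inv (a i))) - m / card A * F x\<bar> \<le> \<delta> * m * card M"
    if a: "a \<in> P" and x: "x \<in> carrier G" for a x
  proof -
    have "a i \<in> carrier G" if "i < m" for i using a A that by (auto simp: P_def PiE_iff)
    then have "(\<Sum>y\<in>Y x. \<Sum>i<m. f y (a i)) = (\<Sum>i<m. h (x \<otimes> inv (a i)))"
      using x by (subst sum.swap) (simp add: sumY)
    moreover have "(\<Sum>y\<in>Y x. \<Sum>a\<in>A. f y a) = F x"
      using x A by (subst sum.swap) (auto simp: sumY F subset_eq intro!: sum.cong)
    moreover have "finite (Y x)" "card (Y x) = card M"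
      using M x injY by (auto simp: Y_def card_image)
    ultimately show ?thesis using a unfolding P_def by force
  qed
  have "P \<subseteq> PiE {..<m} (\<lambda>_. A)" by (auto simp: P_def)
  then obtain b where b: "b \<in> PiE {..<m} (\<lambda>_. A <#> S)"
    and cb: "card S * card P \<le> card (A <#> S) ^ card {..<m} * card {s \<in> S. (\<lambda>i\<in>{..<m}. b i \<otimes> inv s) \<in> P}"
    using popular_translate[of "{..<m}" A S P] A S by blast
  define T where "T = {s \<in> S. (\<lambda>i\<in>{..<m}. b i \<otimes> inv s) \<in> P}"
  have bc: "b i \<in> carrier G" if "i < m" for i
    using that b A S set_mult_closed unfolding PiE_iff by blast
  \<comment> \<open>Moving the point by \<open>s\<close> undoes the shift of the good tuple:
    \<open>x \<otimes> inv s \<otimes> inv (b i \<otimes> inv s) = x \<otimes> inv (b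
    i)\<close>.\<close>
  have shifted: "\<bar>(\<Sum>i<m. h (x \<otimes> inv (b i))) - m / card A * F (x \<otimes> inv s)\<bar> \<le> \<delta> * m * card M"
    if s: "s \<in> T" and x: "x \<in> carrier G" for s x
  proof -
    have sc: "s \<in> carrier G" using s S by (auto simp: T_def)
    have "(\<Sum>i<m. h (x \<otimes> inv s \<otimes> inv ((\<lambda>i\<in>{..<m}. b i \<otimes> inv s) i))) = (\<Sum>i<m. h (x \<otimes> inv (b i)))"
    proof (intro sum.cong refl arg_cong[where f = h])
      fix i assume "i \<in> {..<m}"
      then have "b i \<in> carrier G" "i < m" using bc by auto
      then show "x \<otimes> inv s \<otimes> inv ((\<lambda>i\<in>{..<m}. b i \<otimes> inv s) i) = x \<otimes> inv (b i)"
        using sc x by (simp add: inv_mult_group m_assoc[symmetric]) (simp add: m_assoc)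
    qed
    then show ?thesis using approx[of "\<lambda>i\<in>{..<m}. b i \<otimes> inv s" "x \<otimes> inv s"] s x sc by (simp add: T_def)
  qed
  have K0: "K \<ge> 0" using K cA by (metis of_nat_0_le_iff order_trans zero_le_mult_iff less_le_not_le)
  show ?thesis
  proof (rule that)
    show "T \<subseteq> S" by (auto simp: T_def)
    \<comment> \<open>At least half of all tuples are good, and there are at most
      \<open>(K * card A) ^ m\<close> tuples over \<open>A <#> S\<close>, so the factor
      \<open>card A ^ m\<close> cancels.\<close>
    have "real (card S) * card A ^ m \<le> real (card S) * (2 * card P)"
      using cP by (intro mult_left_mono) (simp_all flip: of_nat_power of_nat_mult)
    also have "\<dots> = 2 * real (card S * card P)" by simp
    also have "\<dots> \<le> 2 * real (card (A <#> S) ^ m * card T)"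
      using cb unfolding T_def card_lessThan by (intro mult_left_mono) (auto simp only: of_nat_le_iff)
    also have "\<dots> \<le> 2 * ((K * card A) ^ m * card T)"
      using K by (simp add: mult_right_mono power_mono)
    also have "\<dots> = (2 * K ^ m * card T) * card A ^ m" by (simp add: power_mult_distrib)
    finally show "card S \<le> 2 * K ^ m * card T"
      using cA by simp
  next
    fix s s' x assume s: "s \<in> T" "s' \<in> T" and x: "x \<in> carrier G"
    have sc: "s \<in> carrier G" "s' \<in> carrier G" using s S by (auto simp: T_def)
    have m0: "m > 0"
    proof -
      have "ln (4 * card L / card M) > 0" using cM card_le by (intro ln_gt_zero) (simp add: field_simps)
      then show ?thesis using m by (cases m) auto
    qed
    have tri: "\<bar>u - v\<bar> \<le> c \<Longrightarrow> \<bar>u - w\<bar> \<le> c \<Longrightarrow> \<bar>w - v\<bar> \<le> 2 * c" for u v w c :: real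
      by linarith
    \<comment> \<open>Both approximations are taken at \<open>x \<otimes> s\<close>, where the one
      belonging to \<open>s\<close> itself concerns \<open>F x\<close>.\<close>
    have "\<bar>m / card A * F (x \<otimes> s \<otimes> inv s') - m / card A * F (x \<otimes> s \<otimes> inv s)\<bar> \<le> 2 * (\<delta> * m * card M)"
      by (rule tri[OF shifted[OF s(1) m_closed[OF x sc(1)]] shifted[OF s(2) m_closed[OF x sc(1)]]])
    also have "x \<otimes> s \<otimes> inv s = x" using x sc by (simp add: m_assoc)
    also have "\<bar>m / card A * F (x \<otimes> s \<otimes> inv s') - m / card A * F x\<bar>
        = m / card A * \<bar>F (x \<otimes> s \<otimes> inv s') - F x\<bar>"
      unfolding right_diff_distrib[symmetric] abs_mult by simp
    also have "2 * (\<delta> * m * card M) = m / card A * (2 * \<delta> * card A * card M)"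
      using cA by simp
    finally have "m / card A * \<bar>F (x \<otimes> s \<otimes> inv s') - F x\<bar> \<le> m / card A * (2 * \<delta> * card A * card M)" .
    then show "\<bar>triple_conv G A M L (x \<otimes> s \<otimes> inv s') - triple_conv G A M L x\<bar> \<le> 2 * \<delta> * card A * card M"
      using cA m0 unfolding F_def by (subst (asm) mult_le_cancel_left_pos) auto
  qed
qed

section \<open>From single differences to iterated ones\<close>

text \<open>By commutativity the element is regrouped into \<open>k\<close> quotients
  \<open>t i \<otimes> inv (t' i)\<close>. Each costs \<open>c\<close>, and the triangle inequality
  adds the costs.\<close>

lemma iterated_difference_set_diff_le:
  fixes F :: "'a \<Rightarrow> real"
  assumes T: "T \<subseteq> carrier G"
    and c: "\<And>s s' x. s \<in> T \<Longrightarrow> s' \<in> T \<Longrightarrow> x \<in> carrier G \<Longrightarrow> \<bar>F (x \<otimes> s \<otimes> inv s') - F x\<bar> \<le> c"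
    and u: "u \<in> iterated_difference_set G k T" and x: "x \<in> carrier G"
  shows "\<bar>F (x \<otimes> u) - F x\<bar> \<le> k * c"
proof -
  have "\<bar>F (x \<otimes> (finprod G t {..<k} \<otimes> inv (finprod G t' {..<k}))) - F x\<bar> \<le> k * c"
    if "t \<in> {..<k} \<rightarrow> T" "t' \<in> {..<k} \<rightarrow> T" for t t'
    using that
  proof (induction k)
    case 0
    then show ?case using x by simp
  next
    case (Suc k)
    let ?p = "finprod G t {..<k}" and ?p' = "finprod G t' {..<k}"
    have tc: "t \<in> {..<k} \<rightarrow> carrier G" "t k \<in> carrier G" "t' \<in> {..<k} \<rightarrow> carrier G" "t' k \<in> carrier G"
      using Suc.prems T by (auto simp: Pi_iff)
    then have pc: "?p \<in> carrier G" "?p' \<in> carrier G" by auto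
    have IH: "\<bar>F (x \<otimes> (?p \<otimes> inv ?p')) - F x\<bar> \<le> k * c"
      using Suc.prems by (intro Suc.IH) auto
    have "x \<otimes> (finprod G t {..<Suc k} \<otimes> inv (finprod G t' {..<Suc k}))
        = x \<otimes> (?p \<otimes> inv ?p') \<otimes> t k \<otimes> inv (t' k)"
      using tc pc x by (simp add: lessThan_Suc inv_mult m_ac)
    moreover have "\<bar>F (x \<otimes> (?p \<otimes> inv ?p') \<otimes> t k \<otimes> inv (t' k)) - F (x \<otimes> (?p \<otimes> inv ?p'))\<bar> \<le> c"
      using Suc.prems pc x by (intro c) auto
    ultimately show ?case using IH by (simp add: algebra_simps)
  qed
  then show ?thesis using u by (auto simp: iterated_difference_set_def)
qed

lemma iterated_difference_set_subset:
  "T \<subseteq> carrier G \<Longrightarrow> iterated_difference_set G k T \<subseteq> carrier G"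
  by (auto simp: iterated_difference_set_def Pi_iff subset_eq intro!: m_closed inv_closed finprod_closed)

lemma exists_almost_period_set:
  fixes \<epsilon> K :: real
  assumes \<epsilon>: "0 < \<epsilon>" "\<epsilon> < 1" and k: "k > 0"
    and A: "finite A" "A \<noteq> {}" "A \<subseteq> carrier G" and M: "finite M" "M \<noteq> {}" "M \<subseteq> carrier G"
    and L: "finite L" "L \<subseteq> carrier G" and S: "finite S" "S \<noteq> {}" "S \<subseteq> carrier G"
    and K: "card (A <#> S) \<le> K * card A" and card_le: "card M \<le> card L"
  obtains T where "T \<subseteq> S"
    "exp (- (34 * (real k)\<^sup>2 * (1 / \<epsilon>\<^sup>2) * ln (2 / (card M / card L)) * ln (2 * K))) * card S \<le> card T"
    "\<And>u x. u \<in> iterated_difference_set G k T \<Longrightarrow> x \<in> carrier G \<Longrightarrow>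
      \<bar>triple_conv G A M L (x \<otimes> u) - triple_conv G A M L x\<bar> \<le> \<epsilon> * card A * card M"
proof -
  \<comment> \<open>There will be \<open>k\<close> quotients, each costing
    \<open>2 * \<delta> * card A * card M\<close>.\<close>
  define \<delta> where "\<delta> = \<epsilon> / (2 * k)"
  define p where "p = ln (2 / (card M / card L))"
  define q where "q = (real k)\<^sup>2 / \<epsilon>\<^sup>2"
  define m where "m = nat \<lceil>4 * ln (4 * card L / card M) / \<delta>\<^sup>2\<rceil>"
  have cA: "real (card A) > 0" and cM: "real (card M) > 0" using A M by (simp_all add: card_gt_0_iff)
  then have cL: "real (card L) > 0" using card_le by simp
  have "\<epsilon> / (2 * k) \<le> 1 / (2 * 1)" using k \<epsilon> by (intro frac_le) auto
  then have \<delta>: "0 < \<delta>" "\<delta> \<le> 1" using \<epsilon> k by (auto simp: \<delta>_def)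
  \<comment> \<open>\<open>A <#> S\<close> contains a translate of \<open>A\<close>. Hence
    \<open>ln (2 * K)\<close> is positive, so \<open>m\<close> may be replaced by an upper bound in
    the exponent.\<close>
  have K1: "K \<ge> 1"
  proof -
    obtain s where s: "s \<in> S" using S by blast
    have "card A = card ((\<lambda>a. a \<otimes> s) ` A)"
      using A S s by (intro card_image[symmetric]) (auto simp: inj_on_def subset_eq)
    also have "\<dots> \<le> card (A <#> S)"
      using A S s by (intro card_mono finite_set_mult) (auto simp: set_mult_def)
    finally have "1 * real (card A) \<le> K * card A" using K by linarith
    then show ?thesis using cA by (simp only: mult_le_cancel_right_pos)
  qed
  have "2 \<le> 2 / (real (card M) / card L)" using cM cL card_le by (simp add: field_simps)
  then have "ln 2 \<le> p" unfolding p_def by (subst ln_le_cancel_iff) auto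
  moreover have half: "1 / 2 \<le> ln (2 :: real)" using exp_bound_half[of "1 / 2 :: real"] by (subst ln_ge_iff) auto
  ultimately have p: "1 / 2 \<le> p" "ln 2 \<le> p" by auto
  have "\<epsilon>\<^sup>2 \<le> 1" using \<epsilon> by (simp add: power_le_one)
  also have "1 \<le> (real k)\<^sup>2" using k by simp
  finally have q: "q \<ge> 1" using \<epsilon> by (simp add: q_def)
  have "ln (4 * card L / card M) = ln (2 * (2 / (real (card M) / card L)))" by simp
  also have "\<dots> = ln 2 + p" unfolding p_def using cM cL by (intro ln_mult_pos) auto
  finally have ln4: "ln (4 * card L / card M) = ln 2 + p" .
  have "0 < 4 * (ln 2 + p) / \<delta>\<^sup>2" using p half \<delta> by (intro divide_pos_pos) auto
  then have m_pos: "m > 0" and m_ge: "4 * (ln 2 + p) / \<delta>\<^sup>2 \<le> m" and m_le: "m \<le> 4 * (ln 2 + p) / \<delta>\<^sup>2 + 1"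
    unfolding m_def ln4 by linarith+
  have m: "4 * ln (4 * card L / card M) \<le> \<delta>\<^sup>2 * m"
    using m_ge \<delta> unfolding ln4 by (simp add: field_simps)
  have "m \<le> 4 * (2 * p) / \<delta>\<^sup>2 + 1"
  proof -
    have "4 * (ln 2 + p) / \<delta>\<^sup>2 \<le> 4 * (2 * p) / \<delta>\<^sup>2" using p by (intro divide_right_mono) auto
    then show ?thesis using m_le by linarith
  qed
  \<comment> \<open>Origin of 34: the definition of \<open>\<delta>\<close> gives 32, and the 1 lost
    in rounding \<open>m\<close> up is at most \<open>2 * (q * p)\<close>, as
    \<open>q \<ge> 1\<close> and \<open>p \<ge> 1 / 2\<close>.\<close>
  also have "4 * (2 * p) / \<delta>\<^sup>2 = 32 * (q * p)"
    by (simp add: \<delta>_def q_def power_divide power_mult_distrib)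
  also have "1 \<le> 2 * (q * p)" using mult_mono[OF q p(1)] q p by simp
  finally have m34: "m \<le> 34 * q * p" by (simp add: mult_ac)
  obtain T where T: "T \<subseteq> S" "card S \<le> 2 * K ^ m * card T"
    "\<And>s s' x. s \<in> T \<Longrightarrow> s' \<in> T \<Longrightarrow> x \<in> carrier G \<Longrightarrow>
      \<bar>triple_conv G A M L (x \<otimes> s \<otimes> inv s') - triple_conv G A M L x\<bar> \<le> 2 * \<delta> * card A * card M"
    using many_almost_periods[OF A M L S K card_le \<delta> m] by blast
  show ?thesis
  proof (rule that[OF T(1)])
    have "real (card S) \<le> 2 * K ^ m * card T" by (rule T(2))
    \<comment> \<open>The factor 2 is absorbed into the power, because \<open>m > 0\<close>.\<close>
    also have "\<dots> \<le> (2 * K) ^ m * card T"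
      using m_pos K1 self_le_power[of "2 :: real" m]
      by (simp add: power_mult_distrib mult_right_mono)
    also have "(2 * K) ^ m = exp (m * ln (2 * K))" using K1 by (simp add: exp_of_nat_mult)
    also have "\<dots> \<le> exp (34 * q * p * ln (2 * K))" using K1 m34 by (auto intro!: mult_right_mono)
    finally have "exp (- (34 * q * p * ln (2 * K))) * card S \<le> card T"
      by (simp add: mult_right_mono exp_minus field_simps)
    then show "exp (- (34 * (real k)\<^sup>2 * (1 / \<epsilon>\<^sup>2) * ln (2 / (card M / card L)) * ln (2 * K))) * card S \<le> card T"
      by (simp add: p_def q_def)
  next
    fix u x assume u: "u \<in> iterated_difference_set G k T" and x: "x \<in> carrier G"
    have "\<bar>triple_conv G A M L (x \<otimes> u) - triple_conv G A M L x\<bar> \<le> k * (2 * \<delta> * card A * card M)"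
      using T S by (intro iterated_difference_set_diff_le[OF _ _ u x]) auto
    then show "\<bar>triple_conv G A M L (x \<otimes> u) - triple_conv G A M L x\<bar> \<le> \<epsilon> * card A * card M"
      using k by (simp add: \<delta>_def)
  qed
qed

lemma almost_periodicity_bound_34: "almost_periodicity_bound 34 G"
  unfolding almost_periodicity_bound_def Let_def
proof (intro allI impI)
  fix \<epsilon> K \<eta> :: real and k :: nat and A M L S
  assume \<epsilon>: "0 < \<epsilon>" "\<epsilon> < 1"
    and A: "A \<subseteq> carrier G" "finite A" "A \<noteq> {}" and M: "M \<subseteq> carrier G" "finite M" "M \<noteq> {}"
    and L: "L \<subseteq> carrier G" "finite L" "L \<noteq> {}" and S: "S \<subseteq> carrier G" "finite S" "S \<noteq> {}"
    and K: "card (A <#> S) \<le> K * card A" and \<eta>: "\<eta> = card M / card L" "\<eta> \<le> 1"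
  have "\<exists>T\<subseteq>S. exp (- (34 * (real k)\<^sup>2 * (1 / \<epsilon>\<^sup>2) * ln (2 / \<eta>) * ln (2 * K))) * card S \<le> card T \<and>
    (\<forall>t\<in>iterated_difference_set G k T. \<forall>x\<in>carrier G.
      \<bar>triple_conv G A M L (x \<otimes> t) - triple_conv G A M L x\<bar> \<le> \<epsilon> * card A * card M)"
  proof (cases "k = 0")
    \<comment> \<open>Here the exponent is 0 and the only iterated difference is the neutral
      element, so \<open>S\<close> itself serves.\<close>
    case True
    then show ?thesis using \<epsilon> by (intro exI[of _ S]) (auto simp: iterated_difference_set_def)
  next
    case False
    have "card M \<le> card L" using \<eta>(2) L unfolding \<eta>(1) by (simp add: divide_le_eq_1 card_gt_0_iff)
    then obtain T where "T \<subseteq> S"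
      "exp (- (34 * (real k)\<^sup>2 * (1 / \<epsilon>\<^sup>2) * ln (2 / (card M / card L)) * ln (2 * K))) * card S \<le> card T"
      "\<And>u x. u \<in> iterated_difference_set G k T \<Longrightarrow> x \<in> carrier G \<Longrightarrow>
        \<bar>triple_conv G A M L (x \<otimes> u) - triple_conv G A M L x\<bar> \<le> \<epsilon> * card A * card M"
      using exists_almost_period_set[of \<epsilon> k A M L S K] \<epsilon> False A M L S K by blast
    then show ?thesis unfolding \<eta>(1) by blast
  qed
  then obtain T where T: "T \<subseteq> S"
    "exp (- (34 * (real k)\<^sup>2 * (1 / \<epsilon>\<^sup>2) * ln (2 / \<eta>) * ln (2 * K))) * card S \<le> card T"
    "\<And>t x. t \<in> iterated_difference_set G k T \<Longrightarrow> x \<in> carrier G \<Longrightarrow>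
      \<bar>triple_conv G A M L (x \<otimes> t) - triple_conv G A M L x\<bar> \<le> \<epsilon> * card A * card M"
    by blast
  have "iterated_difference_set G k T \<subseteq> carrier G"
    using T S by (intro iterated_difference_set_subset) auto
  then show "\<exists>T\<subseteq>S. exp (- (34 * (real k)\<^sup>2 * (1 / \<epsilon>\<^sup>2) * ln (2 / \<eta>) * ln (2 * K))) * card S \<le> card T \<and>
    (\<forall>t\<in>iterated_difference_set G k T.
      sup_norm G (\<lambda>x. conv G (conv G (indicator A) (indicator M)) (indicator L) (x \<otimes> t)
        - conv G (conv G (indicator A) (indicator M)) (indicator L) x) \<le> \<epsilon> * card A * card M)"
    using T A M L by (intro exI[of _ T]) (auto simp: sup_norm_conv_le_iff)
qed

end

section \<open>Transfer from countable groups\<close>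

text \<open>The generated subgroup consists of the products of words in the elements of
  \<open>U\<close> and their inverses, and a countable alphabet has only countably many
  words.\<close>

lemma (in comm_group) countable_subgroup_containing:
  assumes U: "countable U" "U \<subseteq> carrier G"
  obtains N where "subgroup N G" "U \<subseteq> N" "countable N"
proof
  define V where "V = U \<union> m_inv G ` U"
  let ?prod = "\<lambda>xs. foldr (\<otimes>) xs \<one>"
  let ?N = "?prod ` lists V"
  have V: "V \<subseteq> carrier G" using U by (auto simp: V_def)
  have inv_V: "inv y \<in> V" if "y \<in> V" for y using that U by (auto simp: V_def subset_eq)
  have closed: "?prod xs \<in> carrier G" if "xs \<in> lists V" for xs
    using that V by (induction xs) auto
  show "subgroup ?N G"
  proof (rule subgroupI)
    show "?N \<subseteq> carrier G" using closed by blast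
    show "?N \<noteq> {}" by blast
  next
    fix a assume "a \<in> ?N"
    then obtain xs where xs: "xs \<in> lists V" "a = ?prod xs" by blast
    \<comment> \<open>Commutativity makes reversing the word unnecessary.\<close>
    have "inv (?prod xs) = ?prod (map (m_inv G) xs)"
      using xs(1)
    proof (induction xs)
      case (Cons y xs)
      then have "y \<in> carrier G" "?prod xs \<in> carrier G" using V closed by auto
      with Cons show ?case by (simp add: inv_mult)
    qed simp
    moreover have "map (m_inv G) xs \<in> lists V" using xs(1) inv_V by (auto simp: in_lists_conv_set)
    ultimately show "inv a \<in> ?N" using xs by blast
  next
    fix a b assume "a \<in> ?N" "b \<in> ?N"
    then obtain xs ys where xs: "xs \<in> lists V" "a = ?prod xs" and ys: "ys \<in> lists V" "b = ?prod ys"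
      by blast
    have "?prod (xs @ ys) = ?prod xs \<otimes> ?prod ys"
      using xs(1)
    proof (induction xs)
      case Nil
      show ?case using closed[OF ys(1)] by simp
    next
      case (Cons y xs)
      then have "y \<in> carrier G" "?prod xs \<in> carrier G" using V closed by auto
      with Cons closed[OF ys(1)] show ?case by (simp add: m_assoc)
    qed
    moreover have "xs @ ys \<in> lists V" using xs ys by auto
    ultimately show "a \<otimes> b \<in> ?N" using xs ys by (metis imageI)
  qed
  show "U \<subseteq> ?N"
  proof
    fix u assume u: "u \<in> U"
    then have "u = ?prod [u]" "[u] \<in> lists V" using U by (auto simp: V_def)
    then show "u \<in> ?N" by blast
  qed
  show "countable ?N" using U by (intro countable_image countable_lists) (auto simp: V_def)
qed

lemma hom_finprod_comm_group:
  assumes "comm_group H" "comm_group G" "h \<in> hom H G" "finite I" "f \<in> I \<rightarrow> carrier H"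
  shows "h (finprod H f I) = finprod G (\<lambda>i. h (f i)) I"
proof -
  interpret H: comm_group H by fact
  interpret G: comm_group G by fact
  interpret group_hom H G h using assms(3) by unfold_locales
  show ?thesis using assms(4,5)
    by (induction I rule: finite_induct) (auto simp: Pi_iff)
qed

text \<open>
  An embedding preserves all the data of the statement; outside the image of \<open>H\<close> the triple
  convolution vanishes, so the supremum over \<open>G\<close> is no larger than that over \<open>H\<close>.
\<close>

lemma almost_period_set_embedding:
  fixes \<epsilon> \<eta> K C :: real
  assumes comm_groups: "comm_group H" "comm_group G" and h: "h \<in> hom H G" "inj_on h (carrier H)"
    and bound: "almost_periodicity_bound C H" and \<epsilon>: "0 < \<epsilon>" "\<epsilon> < 1"
    and A: "A \<subseteq> h ` carrier H" "finite A" "A \<noteq> {}" and M: "M \<subseteq> h ` carrier H" "finite M" "M \<noteq> {}"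
    and L: "L \<subseteq> h ` carrier H" "finite L" "L \<noteq> {}" and S: "S \<subseteq> h ` carrier H" "finite S" "S \<noteq> {}"
    and K: "card (A <#>\<^bsub>G\<^esub> S) \<le> K * card A" and \<eta>: "\<eta> = card M / card L" "\<eta> \<le> 1"
  obtains T where "T \<subseteq> S"
    "exp (- (C * (real k)\<^sup>2 * (1 / \<epsilon>\<^sup>2) * ln (2 / \<eta>) * ln (2 * K))) * card S \<le> card T"
    "\<And>t x. t \<in> iterated_difference_set G k T \<Longrightarrow> x \<in> carrier G \<Longrightarrow>
      \<bar>triple_conv G A M L (x \<otimes>\<^bsub>G\<^esub> t) - triple_conv G A M L x\<bar> \<le> \<epsilon> * card A * card M"
proof -
  interpret H: comm_group H by fact
  interpret G: comm_group G by fact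
  interpret group_hom H G h using h(1) by unfold_locales
  \<comment> \<open>All sets are pulled back along \<open>h\<close>. Injectivity preserves
    cardinalities, also that of the product set, so the bound in \<open>H\<close> applies with the
    same \<open>K\<close> and \<open>\<eta>\<close>.\<close>
  define pre where "pre U = {x \<in> carrier H. h x \<in> U}" for U
  have pre_carrier: "pre U \<subseteq> carrier H" for U by (auto simp: pre_def)
  have inj: "inj_on h (pre U)" for U using h(2) pre_carrier by (rule inj_on_subset)
  have img: "h ` pre U = U" if "U \<subseteq> h ` carrier H" for U using that by (auto simp: pre_def)
  have card_pre: "card (pre U) = card U" if "U \<subseteq> h ` carrier H" for U
    using card_image[OF inj, of U] img[OF that] by simp
  have fin: "finite (pre U)" if "U \<subseteq> h ` carrier H" "finite U" for U
    using that img inj by (metis finite_image_iff)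
  have ne: "pre U \<noteq> {}" if "U \<subseteq> h ` carrier H" "U \<noteq> {}" for U
    using img[OF that(1)] that(2) by auto
  have "h ` (pre A <#>\<^bsub>H\<^esub> pre S) = A <#>\<^bsub>G\<^esub> S"
  proof -
    have "h ` (pre A <#>\<^bsub>H\<^esub> pre S) = h ` pre A <#>\<^bsub>G\<^esub> h ` pre S"
      using pre_carrier by (intro set_mult_hom[OF h(1)]) auto
    then show ?thesis using img A S by simp
  qed
  moreover have "inj_on h (pre A <#>\<^bsub>H\<^esub> pre S)"
    using h(2) H.set_mult_closed[OF pre_carrier pre_carrier] by (rule inj_on_subset)
  ultimately have "card (pre A <#>\<^bsub>H\<^esub> pre S) = card (A <#>\<^bsub>G\<^esub> S)" by (metis card_image)
  then have K': "card (pre A <#>\<^bsub>H\<^esub> pre S) \<le> K * card (pre A)" using K A card_pre by simp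
  have \<eta>': "\<eta> = card (pre M) / card (pre L)" using \<eta> M L card_pre by simp
  obtain T' where T': "T' \<subseteq> pre S"
    "exp (- (C * (real k)\<^sup>2 * (1 / \<epsilon>\<^sup>2) * ln (2 / \<eta>) * ln (2 * K))) * card (pre S) \<le> card T'"
    "\<forall>t\<in>iterated_difference_set H k T'. sup_norm H (\<lambda>x.
       conv H (conv H (indicator (pre A)) (indicator (pre M))) (indicator (pre L)) (x \<otimes>\<^bsub>H\<^esub> t)
       - conv H (conv H (indicator (pre A)) (indicator (pre M))) (indicator (pre L)) x)
       \<le> \<epsilon> * card (pre A) * card (pre M)"
    using bound[unfolded almost_periodicity_bound_def Let_def, rule_format,
        OF \<epsilon> pre_carrier fin[OF A(1,2)] ne[OF A(1,3)] pre_carrier fin[OF M(1,2)] ne[OF M(1,3)]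
          pre_carrier fin[OF L(1,2)] ne[OF L(1,3)] pre_carrier fin[OF S(1,2)] ne[OF S(1,3)] K' \<eta>' \<eta>(2),
        of k]
    by blast
  have T'c: "T' \<subseteq> carrier H" using T' pre_carrier by blast
  have H_bound: "\<bar>triple_conv H (pre A) (pre M) (pre L) (x \<otimes>\<^bsub>H\<^esub> t) - triple_conv H (pre A) (pre M) (pre L) x\<bar>
      \<le> \<epsilon> * card A * card M" if "t \<in> iterated_difference_set H k T'" "x \<in> carrier H" for t x
  proof -
    have t: "t \<in> carrier H" using that H.iterated_difference_set_subset[OF T'c] by blast
    have "\<forall>x\<in>carrier H. \<bar>triple_conv H (pre A) (pre M) (pre L) (x \<otimes>\<^bsub>H\<^esub> t)
        - triple_conv H (pre A) (pre M) (pre L) x\<bar> \<le> \<epsilon> * card (pre A) * card (pre M)"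
      using bspec[OF T'(3) that(1)]
      unfolding H.sup_norm_conv_le_iff[OF fin[OF A(1,2)] pre_carrier fin[OF M(1,2)] pre_carrier fin[OF L(1,2)] t] .
    then show ?thesis using that card_pre[OF A(1)] card_pre[OF M(1)] by simp
  qed
  have conv_eq: "triple_conv G A M L (h x) = triple_conv H (pre A) (pre M) (pre L) x" if x: "x \<in> carrier H" for x
  proof -
    have "triple_conv G (h ` pre A) (h ` pre M) L (h x) = triple_conv H (pre A) (pre M) (pre L) x"
      unfolding triple_conv_def sum.reindex[OF inj] comp_def
    proof (intro sum.cong refl)
      fix a z assume "a \<in> pre A" "z \<in> pre M"
      then have az: "a \<in> carrier H" "z \<in> carrier H" using pre_carrier by auto
      then have "h x \<otimes>\<^bsub>G\<^esub> inv\<^bsub>G\<^esub> h a \<otimes>\<^bsub>G\<^esub> inv\<^bsub>G\<^esub> h z = h (x \<otimes>\<^bsub>H\<^esub> inv\<^bsub>H\<^esub> a \<otimes>\<^bsub>H\<^esub> inv\<^bsub>H\<^esub> z)"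
        using x by simp
      then show "indicat_real L (h x \<otimes>\<^bsub>G\<^esub> inv\<^bsub>G\<^esub> h a \<otimes>\<^bsub>G\<^esub> inv\<^bsub>G\<^esub> h z)
          = indicator (pre L) (x \<otimes>\<^bsub>H\<^esub> inv\<^bsub>H\<^esub> a \<otimes>\<^bsub>H\<^esub> inv\<^bsub>H\<^esub> z)"
        using az x by (simp add: indicator_def pre_def)
    qed
    then show ?thesis using img A M by simp
  qed
  let ?N = "h ` carrier H"
  have N: "subgroup ?N G" by (rule img_is_subgroup)
  \<comment> \<open>Preimages are chosen factor by factor; \<open>h\<close> commutes with the finite
    products.\<close>
  have preimage: "\<exists>t'\<in>iterated_difference_set H k T'. t = h t'"
    if t: "t \<in> iterated_difference_set G k (h ` T')" for t
  proof -
    obtain u v where uv: "u \<in> {..<k} \<rightarrow> h ` T'" "v \<in> {..<k} \<rightarrow> h ` T'"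
      and t: "t = finprod G u {..<k} \<otimes>\<^bsub>G\<^esub> inv\<^bsub>G\<^esub> (finprod G v {..<k})"
      using t by (auto simp: iterated_difference_set_def)
    have lift: "\<exists>w'\<in>{..<k} \<rightarrow> T'. finprod G w {..<k} = h (finprod H w' {..<k})"
      if w: "w \<in> {..<k} \<rightarrow> h ` T'" for w
    proof
      let ?w = "\<lambda>i. inv_into T' h (w i)"
      show w': "?w \<in> {..<k} \<rightarrow> T'" using w by (auto simp: Pi_iff inv_into_into)
      have "h (finprod H ?w {..<k}) = finprod G (\<lambda>i. h (?w i)) {..<k}"
        using w' T'c by (intro hom_finprod_comm_group comm_groups h) (auto simp: Pi_iff)
      also have "\<dots> = finprod G w {..<k}"
      proof (intro G.finprod_cong')
        have "h ` T' \<subseteq> carrier G" using T'c by auto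
        then show "w \<in> {..<k} \<rightarrow> carrier G" using w by blast
      qed (use w in \<open>auto simp: Pi_iff f_inv_into_f\<close>)
      finally show "finprod G w {..<k} = h (finprod H ?w {..<k})" by simp
    qed
    obtain u' v' where u': "u' \<in> {..<k} \<rightarrow> T'" "finprod G u {..<k} = h (finprod H u' {..<k})"
      and v': "v' \<in> {..<k} \<rightarrow> T'" "finprod G v {..<k} = h (finprod H v' {..<k})"
      using lift[OF uv(1)] lift[OF uv(2)] by blast
    have "finprod H u' {..<k} \<in> carrier H" "finprod H v' {..<k} \<in> carrier H"
      using u' v' T'c by (auto intro!: H.finprod_closed)
    then have "t = h (finprod H u' {..<k} \<otimes>\<^bsub>H\<^esub> inv\<^bsub>H\<^esub> finprod H v' {..<k})"
      using t u' v' by simp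
    then show ?thesis using u'(1) v'(1) unfolding iterated_difference_set_def by blast
  qed
  show ?thesis
  proof
    show "h ` T' \<subseteq> S" using T'(1) by (auto simp: pre_def)
    show "exp (- (C * (real k)\<^sup>2 * (1 / \<epsilon>\<^sup>2) * ln (2 / \<eta>) * ln (2 * K))) * card S \<le> card (h ` T')"
      using T'(2) card_pre[OF S(1)] card_image[OF inj_on_subset[OF h(2) T'c]] by simp
  next
    fix t x assume t: "t \<in> iterated_difference_set G k (h ` T')" and x: "x \<in> carrier G"
    obtain t' where t': "t' \<in> iterated_difference_set H k T'" "t = h t'" using preimage[OF t] by blast
    have t'c: "t' \<in> carrier H" using t' H.iterated_difference_set_subset[OF T'c] by blast
    show "\<bar>triple_conv G A M L (x \<otimes>\<^bsub>G\<^esub> t) - triple_conv G A M L x\<bar> \<le> \<epsilon> * card A * card M"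
    proof (cases "x \<in> ?N")
      case True
      then obtain x' where x': "x' \<in> carrier H" "x = h x'" by blast
      then have xt: "x \<otimes>\<^bsub>G\<^esub> t = h (x' \<otimes>\<^bsub>H\<^esub> t')" using t' t'c by simp
      show ?thesis
        using H_bound[OF t'(1) x'(1)]
        unfolding xt conv_eq[OF H.m_closed[OF x'(1) t'c]] unfolding x'(2) conv_eq[OF x'(1)] .
    next
      \<comment> \<open>As \<open>t\<close> lies in the image subgroup, the translate of
        \<open>x\<close> by \<open>t\<close> stays outside it along with \<open>x\<close>, and both
        values are 0.\<close>
      case False
      have tN: "t \<in> ?N" using t' t'c by blast
      have tc: "t \<in> carrier G" using t' t'c by simp
      have "x \<otimes>\<^bsub>G\<^esub> t \<notin> ?N"
      proof
        assume "x \<otimes>\<^bsub>G\<^esub> t \<in> ?N"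
        then have "x \<otimes>\<^bsub>G\<^esub> t \<otimes>\<^bsub>G\<^esub> inv\<^bsub>G\<^esub> t \<in> ?N"
          by (rule subgroup.m_closed[OF N _ subgroup.m_inv_closed[OF N tN]])
        then show False using False x tc by (simp add: G.m_assoc)
      qed
      then show ?thesis
        using False x tc \<epsilon> by (simp add: G.triple_conv_eq_0[OF N A(1) M(1) L(1)])
    qed
  qed
qed

text \<open>The group structure is transported along the enumeration \<open>to_nat_on N\<close>,
  which is injective for finite and infinite countable \<open>N\<close> alike.\<close>

lemma (in comm_group) countable_subgroup_nat_copy:
  assumes N: "subgroup N G" "countable N"
  obtains H :: "nat monoid" and h where "comm_group H" "h \<in> hom H G" "inj_on h (carrier H)" "h ` carrier H = N"
proof -
  let ?N = "G\<lparr>carrier := N\<rparr>"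
  let ?f = "to_nat_on N" and ?h = "from_nat_into N"
  interpret N: comm_group ?N
    using subgroup.mem_carrier[OF N(1)]
    by (intro group.group_comm_groupI subgroup.subgroup_is_group[OF N(1) group_axioms]) (simp add: m_comm)
  define H :: "nat monoid" where
    "H = \<lparr>carrier = ?f ` N, monoid.mult = (\<lambda>x y. ?f (?h x \<otimes> ?h y)), one = ?f \<one>\<rparr>"
  have hf: "?h (?f x) = x" if "x \<in> N" for x using that N(2) by simp
  have "?f \<in> hom ?N H" using hf by (auto simp: hom_def H_def subgroup.m_closed[OF N(1)])
  then have "comm_group (H\<lparr>carrier := ?f ` carrier ?N, one := ?f \<one>\<^bsub>?N\<^esub>\<rparr>)"
    by (rule N.hom_imp_img_comm_group)
  then have "comm_group H" by (simp add: H_def)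
  moreover have "?h \<in> hom H G"
    using hf subgroup.mem_carrier[OF N(1)] subgroup.m_closed[OF N(1)] by (auto simp: hom_def H_def)
  moreover have "inj_on ?h (carrier H)" using hf by (auto simp: H_def inj_on_def)
  moreover have "?h ` carrier H = N" using hf by (force simp: H_def image_image)
  ultimately show ?thesis by (rule that)
qed

text \<open>The theorem concerns every \<open>C\<close> that works on \<open>nat\<close>, possibly
  one below 34, so \<open>almost_periodicity_bound_34\<close> is not enough. The four finite sets
  lie in a countable subgroup, whose copy on \<open>nat\<close> supplies the bound with the given
  \<open>C\<close>.\<close>

lemma (in comm_group) almost_periodicity_bound_transfer:
  assumes nat: "\<And>H :: nat monoid. comm_group H \<Longrightarrow> almost_periodicity_bound C H"
  shows "almost_periodicity_bound C G"
  unfolding almost_periodicity_bound_def Let_def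
proof (intro allI impI)
  fix \<epsilon> K \<eta> :: real and k :: nat and A M L S
  assume \<epsilon>: "0 < \<epsilon>" "\<epsilon> < 1"
    and A: "A \<subseteq> carrier G" "finite A" "A \<noteq> {}" and M: "M \<subseteq> carrier G" "finite M" "M \<noteq> {}"
    and L: "L \<subseteq> carrier G" "finite L" "L \<noteq> {}" and S: "S \<subseteq> carrier G" "finite S" "S \<noteq> {}"
    and K: "card (A <#> S) \<le> K * card A" and \<eta>: "\<eta> = card M / card L" "\<eta> \<le> 1"
  have "countable (A \<union> M \<union> L \<union> S)" "A \<union> M \<union> L \<union> S \<subseteq> carrier G"
    using A M L S by (auto simp: countable_finite)
  then obtain N where N: "subgroup N G" "A \<union> M \<union> L \<union> S \<subseteq> N" "countable N"
    by (rule countable_subgroup_containing)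
  obtain H :: "nat monoid" and h where H: "comm_group H"
    and h: "h \<in> hom H G" "inj_on h (carrier H)" "h ` carrier H = N"
    using countable_subgroup_nat_copy[OF N(1,3)] by blast
  have sub: "A \<subseteq> h ` carrier H" "M \<subseteq> h ` carrier H" "L \<subseteq> h ` carrier H" "S \<subseteq> h ` carrier H"
    using N(2) h(3) by auto
  obtain T where T: "T \<subseteq> S"
    "exp (- (C * (real k)\<^sup>2 * (1 / \<epsilon>\<^sup>2) * ln (2 / \<eta>) * ln (2 * K))) * card S \<le> card T"
    "\<And>t x. t \<in> iterated_difference_set G k T \<Longrightarrow> x \<in> carrier G \<Longrightarrow>
      \<bar>triple_conv G A M L (x \<otimes> t) - triple_conv G A M L x\<bar> \<le> \<epsilon> * card A * card M"
    using almost_period_set_embedding[where k = k, OF H comm_group_axioms h(1,2) nat[OF H] \<epsilon>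
        sub(1) A(2,3) sub(2) M(2,3) sub(3) L(2,3) sub(4) S(2,3) K \<eta>] by blast
  have "iterated_difference_set G k T \<subseteq> carrier G"
    using T S by (intro iterated_difference_set_subset) auto
  then show "\<exists>T\<subseteq>S. exp (- (C * (real k)\<^sup>2 * (1 / \<epsilon>\<^sup>2) * ln (2 / \<eta>) * ln (2 * K))) * card S \<le> card T \<and>
    (\<forall>t\<in>iterated_difference_set G k T.
      sup_norm G (\<lambda>x. conv G (conv G (indicator A) (indicator M)) (indicator L) (x \<otimes> t)
        - conv G (conv G (indicator A) (indicator M)) (indicator L) x) \<le> \<epsilon> * card A * card M)"
    using T A M L by (intro exI[of _ T]) (auto simp: sup_norm_conv_le_iff)
qed

theorem theorem5p1:
  shows "(\<exists>C>0. \<forall>H :: nat monoid. comm_group H \<longrightarrow> almost_periodicity_bound C H) \<and>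
         (\<forall>C>0. (\<forall>H :: nat monoid. comm_group H \<longrightarrow> almost_periodicity_bound C H) \<longrightarrow>
                (\<forall>G :: 'a monoid. comm_group G \<longrightarrow> almost_periodicity_bound C G))"
proof (intro conjI allI impI)
  show "\<exists>C>0. \<forall>H :: nat monoid. comm_group H \<longrightarrow> almost_periodicity_bound C H"
    using comm_group.almost_periodicity_bound_34 by (intro exI[of _ 34]) auto
next
  fix C :: real and G :: "'a monoid"
  assume nat: "\<forall>H :: nat monoid. comm_group H \<longrightarrow> almost_periodicity_bound C H"
    and G: "comm_group G"
  show "almost_periodicity_bound C G"
    by (rule comm_group.almost_periodicity_bound_transfer[OF G]) (use nat in blast)
qed

end
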